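(* If $P$ arises from a random walk on a vertex-transitive graph, then $r(x)$ is constant in $x$; hence, $L(P)=1$.
   Context: $P$ is a Markov transition kernel on a finite state space $S$ with $|S|\ge2$, with a stationary distribution $\pi$ of full support ($\pi(x)>0$ for all $x\in S$). A graph is vertex-transitive if its automorphism group acts transitively on its vertices. All logarithms are natural, with $0\log0=0$. $D_{\mathrm{KL}}(\mu\|\nu)=\sum_{x\in S}\mu(x)\log\frac{\mu(x)}{\nu(x)}$. The local KL retention ratio is $r(x):=D_{\mathrm{KL}}(P(x,\cdot)\|\pi)/\log(1/\pi(x))$; $\bar r_\pi:=\sum_{x\in S}\pi(x)r(x)$; $M:=\max_{x\in S}r(x)$; the localization ratio is $L(P):=\bar r_\pi/M$, with the convention $L(P)=1$ when $\bar r_\pi=M=0$.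
   Formalization: It is additionally assumed that the graph is connected or that π is the degree-proportional stationary distribution; without this the claim fails, e.g. on two disjoint triangles given unequal total π-mass. *)

theory Defs
  imports "HOL-Probability.Probability" "Graph_Theory.Graph_Theory"
begin

text \<open>
  A kernel on the finite state space \<open>S\<close> is a function into probability mass functions;
  its values outside \<open>S\<close> are irrelevant.
\<close>

definition kernel_on :: "'a set \<Rightarrow> ('a \<Rightarrow> 'a pmf) \<Rightarrow> bool" where
  "kernel_on S P \<longleftrightarrow> (\<forall>x\<in>S. set_pmf (P x) \<subseteq> S)"

definition stationary :: "('a \<Rightarrow> 'a pmf) \<Rightarrow> 'a pmf \<Rightarrow> bool" where
  "stationary P \<pi> \<longleftrightarrow> bind_pmf \<pi> P = \<pi>"

text \<open>Since \<open>ln 0 = 0\<close> and \<open>0 * t = 0\<close>, the convention \<open>0 log 0 = 0\<close> is built in.\<close>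

definition KL_div :: "'a set \<Rightarrow> 'a pmf \<Rightarrow> 'a pmf \<Rightarrow> real" where
  "KL_div S \<mu> \<nu> = (\<Sum>x\<in>S. pmf \<mu> x * ln (pmf \<mu> x / pmf \<nu> x))"

definition retention :: "'a set \<Rightarrow> ('a \<Rightarrow> 'a pmf) \<Rightarrow> 'a pmf \<Rightarrow> 'a \<Rightarrow> real" where
  "retention S P \<pi> x = KL_div S (P x) \<pi> / ln (1 / pmf \<pi> x)"

definition mean_retention :: "'a set \<Rightarrow> ('a \<Rightarrow> 'a pmf) \<Rightarrow> 'a pmf \<Rightarrow> real" where
  "mean_retention S P \<pi> = (\<Sum>x\<in>S. pmf \<pi> x * retention S P \<pi> x)"

definition max_retention :: "'a set \<Rightarrow> ('a \<Rightarrow> 'a pmf) \<Rightarrow> 'a pmf \<Rightarrow> real" where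
  "max_retention S P \<pi> = Max (retention S P \<pi> ` S)"

definition localization_ratio :: "'a set \<Rightarrow> ('a \<Rightarrow> 'a pmf) \<Rightarrow> 'a pmf \<Rightarrow> real" where
  "localization_ratio S P \<pi> =
     (if mean_retention S P \<pi> = 0 \<and> max_retention S P \<pi> = 0 then 1
      else mean_retention S P \<pi> / max_retention S P \<pi>)"

text \<open>An automorphism is a digraph isomorphism whose image graph is \<open>G\<close> itself.\<close>

definition vertex_transitive :: "('a, 'b) pre_digraph \<Rightarrow> bool" where
  "vertex_transitive G \<longleftrightarrow>
     (\<forall>u\<in>verts G. \<forall>v\<in>verts G. \<exists>f.
        pre_digraph.digraph_isomorphism G f \<and> app_iso f G = G \<and> iso_verts f u = v)"

text \<open>
  \<open>graph\<close> is a finite simple undirected graph, each edge being a pair of opposite arcs, so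
  that \<open>out_degree G x\<close> is the degree of \<open>x\<close>. Isolated vertices are excluded implicitly,
  because the weights of \<open>P x\<close> have to sum to 1.
\<close>

definition random_walk_on :: "('a, 'b) pre_digraph \<Rightarrow> ('a \<Rightarrow> 'a pmf) \<Rightarrow> bool" where
  "random_walk_on G P \<longleftrightarrow>
     (\<forall>x\<in>verts G. \<forall>y\<in>verts G.
        pmf (P x) y = (if x \<rightarrow>\<^bsub>G\<^esub> y then 1 / real (out_degree G x) else 0))"

text \<open>
  The stationary distribution of the random walk, proportional to the degree. It is the only
  one if the graph is connected; otherwise the mass can be distributed arbitrarily among the
  connected components, and the retention ratio may then differ between components.
\<close>

definition degree_distribution :: "('a, 'b) pre_digraph \<Rightarrow> 'a pmf \<Rightarrow> bool" where
  "degree_distribution G \<pi> \<longleftrightarrow>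
     (\<forall>x\<in>verts G. pmf \<pi> x = real (out_degree G x) / (\<Sum>y\<in>verts G. real (out_degree G y)))"

end

theory Submission
  imports Defs
begin

text \<open>
  An automorphism preserves degrees, so a vertex-transitive graph is \<open>d\<close>-regular and the walk
  has a symmetric transition matrix. If the graph is connected, \<open>\<pi>\<close> is therefore harmonic, and
  constant by the maximum principle; the degree distribution is constant as well. With
  \<open>\<pi> = 1 / n\<close>, every row of \<open>P\<close> is uniform on \<open>d\<close> points and
  \<open>r x = ln (n / d) / ln n\<close> for all \<open>x\<close>.
\<close>

lemma vertex_transitive_out_degree:
  assumes "wf_digraph G" "vertex_transitive G" "u \<in> verts G" "v \<in> verts G"
  shows "out_degree G u = out_degree G v"
proof -
  interpret wf_digraph G by fact
  obtain f where "digraph_isomorphism f" "app_iso f G = G" "iso_verts f u = v"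
    using assms unfolding vertex_transitive_def by blast
  with out_degree_app_iso_eq[of f u] assms(3) show ?thesis by metis
qed

lemma stationary_pmf:
  assumes "finite S" "set_pmf \<pi> \<subseteq> S" "stationary P \<pi>"
  shows "pmf \<pi> y = (\<Sum>x\<in>S. pmf \<pi> x * pmf (P x) y)"
proof -
  have "pmf \<pi> y = pmf (bind_pmf \<pi> P) y"
    using assms(3) by (simp add: stationary_def)
  also have "\<dots> = (\<Sum>x\<in>S. pmf \<pi> x * pmf (P x) y)"
    using assms(1,2) by (subst pmf_bind, subst integral_measure_pmf[of S]) auto
  finally show ?thesis .
qed

text \<open>The equality case of averaging: the terms \<open>(m - g x) * p x\<close> are nonnegative
  and sum to zero, so each one vanishes. This is the local step of the maximum principle.\<close>

lemma convex_combination_max: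
  fixes g p :: "'a \<Rightarrow> real"
  assumes "finite S" "\<And>x. x \<in> S \<Longrightarrow> 0 \<le> p x" "sum p S = 1"
    and "(\<Sum>x\<in>S. g x * p x) = m" "\<And>x. x \<in> S \<Longrightarrow> g x \<le> m"
    and "z \<in> S" "p z \<noteq> 0"
  shows "g z = m"
proof -
  have "(\<Sum>x\<in>S. (m - g x) * p x) = m * sum p S - (\<Sum>x\<in>S. g x * p x)"
    by (simp add: left_diff_distrib sum_subtractf sum_distrib_left)
  then have "(\<Sum>x\<in>S. (m - g x) * p x) = 0"
    using assms(3,4) by simp
  then have "(m - g z) * p z = 0"
    using assms sum_nonneg_eq_0_iff[of S "\<lambda>x. (m - g x) * p x"] by auto
  then show ?thesis using assms(7) by simp
qed

text \<open>The maximum of \<open>pmf \<pi>\<close> is attained at some \<open>w\<close>.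
  Harmonicity passes it from a vertex to all its neighbours, and connectedness carries it to every
  vertex.\<close>

lemma regular_stationary_const:
  assumes "graph G" "Digraph_Component.connected G"
    and kernel: "kernel_on (verts G) P" and walk: "random_walk_on G P"
    and reg: "\<And>x. x \<in> verts G \<Longrightarrow> out_degree G x = d"
    and stat: "stationary P \<pi>" and supp: "set_pmf \<pi> \<subseteq> verts G"
    and uv: "u \<in> verts G" "v \<in> verts G"
  shows "pmf \<pi> u = pmf \<pi> v"
proof -
  interpret graph G by fact
  let ?S = "verts G"
  \<comment> \<open>Arcs come in opposite pairs, and both ends have the same degree
    \<open>d\<close>.\<close>
  have sym: "pmf (P x) y = pmf (P y) x" if "x \<in> ?S" "y \<in> ?S" for x y
    using that walk reg graph_symmetric unfolding random_walk_on_def by auto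
  \<comment> \<open>Connectedness is strong connectedness of the symmetric closure, which has the
    same reachability as \<open>G\<close> because the arcs are already symmetric.\<close>
  have reach: "x \<rightarrow>\<^sup>*\<^bsub>G\<^esub> y" if "x \<in> ?S" "y \<in> ?S" for x y
    using assms(2) that reachable_mk_symmetric_eq[OF sym_arcs]
    by (auto simp: Digraph_Component.connected_def strongly_connected_def)
  let ?m = "Max (pmf \<pi> ` ?S)"
  have "?m \<in> pmf \<pi> ` ?S"
    using uv by (intro Max_in) auto
  then obtain w where w: "w \<in> ?S" "pmf \<pi> w = ?m" by auto
  have max: "pmf \<pi> y = ?m" if "y \<in> ?S" for y
  proof -
    from reach[OF w(1) that] show ?thesis
    proof (induction rule: reachable_induct)
      case base
      show ?case by (fact w(2))
    next
      case (step x y)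
      then have xS: "x \<in> ?S" and yS: "y \<in> ?S"
        by (auto simp: reachable_in_verts adj_in_verts)
      \<comment> \<open>Needed for a positive weight \<open>1 / d\<close> on the step from
        \<open>x\<close> to \<open>y\<close>, since division by zero would yield 0. The arc itself
        witnesses that the degree is nonzero.\<close>
      have dpos: "d \<noteq> 0"
      proof -
        have "finite (out_arcs G x)" "out_arcs G x \<noteq> {}"
          using step by (auto simp: arcs_ends_def arc_to_ends_def out_arcs_def)
        then show ?thesis using reg[OF xS] by (auto simp: out_degree_def)
      qed
      show ?case
      proof (rule convex_combination_max[of ?S "pmf (P x)"])
        show "sum (pmf (P x)) ?S = 1"
          using kernel xS by (intro sum_pmf_eq_1) (auto simp: kernel_on_def)
        \<comment> \<open>Symmetry exchanges row and column of \<open>P\<close>, so the stationarity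
          equation at \<open>x\<close> says that \<open>pmf \<pi> x\<close> is the average of
          \<open>pmf \<pi>\<close> over the row \<open>P x\<close>.\<close>
        have "(\<Sum>z\<in>?S. pmf \<pi> z * pmf (P x) z) = (\<Sum>z\<in>?S. pmf \<pi> z * pmf (P z) x)"
          using sym xS by (intro sum.cong) auto
        also have "\<dots> = pmf \<pi> x"
          using stationary_pmf[OF _ supp stat, of x] by simp
        finally show "(\<Sum>z\<in>?S. pmf \<pi> z * pmf (P x) z) = ?m"
          using step by simp
        show "pmf (P x) y \<noteq> 0"
          using walk xS yS step dpos reg by (auto simp: random_walk_on_def)
      qed (use yS in auto)
    qed
  qed
  show ?thesis using max uv by simp
qed

text \<open>Wherever the row is nonzero, the quotient inside the logarithm is
  \<open>(1 / d) / (1 / card S)\<close>. This constant logarithm factors out of the sum, and the row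
  has total mass 1; the zero entries contribute nothing.\<close>

lemma retention_regular_uniform:
  assumes fin: "finite S" and "x \<in> S" and d: "d > 0"
    and supp: "set_pmf (P x) \<subseteq> S"
    and row: "\<And>y. y \<in> S \<Longrightarrow> pmf (P x) y \<in> {0, 1 / d}"
    and unif: "\<And>y. y \<in> S \<Longrightarrow> pmf \<pi> y = 1 / real (card S)"
  shows "retention S P \<pi> x = ln (real (card S) / d) / ln (real (card S))"
proof -
  have "KL_div S (P x) \<pi> = (\<Sum>y\<in>S. pmf (P x) y * ln (real (card S) / d))"
    unfolding KL_div_def
  proof (intro sum.cong refl)
    fix y assume "y \<in> S"
    with row[of y] unif[of y]
    show "pmf (P x) y * ln (pmf (P x) y / pmf \<pi> y) = pmf (P x) y * ln (real (card S) / d)"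
      by auto
  qed
  also have "\<dots> = ln (real (card S) / d)"
    using sum_pmf_eq_1[OF fin supp] by (simp add: sum_distrib_right[symmetric])
  finally show ?thesis
    using unif[OF \<open>x \<in> S\<close>] by (simp add: retention_def)
qed

text \<open>Mean and maximum both equal \<open>c\<close>. The quotient is 1 if \<open>c\<close> is
  nonzero, and the convention covers \<open>c = 0\<close>.\<close>

lemma localization_ratio_const:
  assumes "finite S" "set_pmf \<pi> = S" "\<And>x. x \<in> S \<Longrightarrow> retention S P \<pi> x = c"
  shows "localization_ratio S P \<pi> = 1"
proof -
  have "S \<noteq> {}" using assms(2) set_pmf_not_empty by metis
  then have "retention S P \<pi> ` S = {c}" using assms(3) by auto
  then have "max_retention S P \<pi> = c"
    by (simp add: max_retention_def)
  moreover have "mean_retention S P \<pi> = c"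
    using assms sum_pmf_eq_1[of S \<pi>]
    by (simp add: mean_retention_def sum_distrib_right[symmetric])
  ultimately show ?thesis by (simp add: localization_ratio_def)
qed

theorem proposition9p3:
  fixes S :: "'a set" and P :: "'a \<Rightarrow> 'a pmf" and \<pi> :: "'a pmf" and G :: "('a, 'b) pre_digraph"
  assumes "finite S" and "card S \<ge> 2"
    and "kernel_on S P"
    and "stationary P \<pi>" and "set_pmf \<pi> = S"
    and "graph G" and "verts G = S"
    and "vertex_transitive G"
    and "random_walk_on G P"
    and "Digraph_Component.connected G \<or> degree_distribution G \<pi>"
  shows "(\<exists>c. \<forall>x\<in>S. retention S P \<pi> x = c) \<and> localization_ratio S P \<pi> = 1"
proof -
  interpret graph G by fact
  obtain v where v: "v \<in> S" using assms(2) by fastforce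
  define d where "d = out_degree G v"
  have reg: "out_degree G x = d" if "x \<in> S" for x
    unfolding d_def using vertex_transitive_out_degree[OF wf_digraph assms(8)] that v assms(7) by blast
  have row: "pmf (P x) y \<in> {0, 1 / real d}" if "x \<in> S" "y \<in> S" for x y
    using assms(7,9) reg that by (auto simp: random_walk_on_def)
  have supp: "set_pmf (P x) \<subseteq> S" if "x \<in> S" for x
    using assms(3) that by (auto simp: kernel_on_def)
  have "d \<noteq> 0"
  proof
    \<comment> \<open>Here \<open>1 / real d\<close> is 0 as well, so the whole row of
      \<open>v\<close> would vanish.\<close>
    assume "d = 0"
    then have "(\<Sum>y\<in>S. pmf (P v) y) = 0" using row[OF v] by (intro sum.neutral) auto
    then show False using sum_pmf_eq_1[OF assms(1) supp[OF v]] by simp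
  qed
  have const: "pmf \<pi> x = pmf \<pi> v" if "x \<in> S" for x
    using assms(10)
  proof
    assume "Digraph_Component.connected G"
    then show ?thesis
      using regular_stationary_const[of G P d \<pi> x v] assms reg that v by simp
  next
    assume "degree_distribution G \<pi>"
    then show ?thesis using reg that v assms(7) by (simp add: degree_distribution_def)
  qed
  have "real (card S) * pmf \<pi> v = 1"
    using sum_pmf_eq_1[of S \<pi>] assms(1,5) const by simp
  then have "pmf \<pi> v = 1 / real (card S)"
    using assms(2) by (simp add: field_simps)
  then have unif: "pmf \<pi> x = 1 / real (card S)" if "x \<in> S" for x
    using const[OF that] by simp
  have "retention S P \<pi> x = ln (real (card S) / real d) / ln (real (card S))" if "x \<in> S" for x
    using retention_regular_uniform[OF assms(1) that, of "real d" P \<pi>] \<open>d \<noteq> 0\<close> supp row unif that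
    by auto
  then show ?thesis using localization_ratio_const[OF assms(1,5)] by blast
qed

end
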